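(* Let $I=[X_0,X_N]$, the space $C$ with metric $d_\infty$, the subsets $C^{\ast}$ and $C^{\ast\ast}$, the functions $L$, $S$, $b$, $h$, the number $s$ and the operator $T$ be as in the context. Then the mapping $T:C^{\ast}\to C^{\ast\ast}$ satisfies $$d_\infty(Tg_1,Tg_2)\le s\, d_\infty(g_1,g_2)\qquad\text{for all } g_1,g_2\in C^{\ast}.$$ In particular, if $s<1$ then $T$ is a contraction and it possesses a unique fixed point $f\in C^{\ast\ast}$.
   Context: Let $N\ge 1$ be an integer and let $(X_j,Y_j)\in\mathbb{R}^2$, $j=0,1,\dots,N$, be points with $X_0<X_1<\cdots<X_N$. Put $I=[X_0,X_N]$. For $n=1,\dots,N$ let $l_n:I\to[X_{n-1},X_n]$ be a continuous bijection. Define $L:I\to I$ by $L(x)=l_n^{-1}(x)$ for $x\in[X_{n-1},X_n)$, $n=1,\dots,N$, where for $n=N$ the interval is taken to be $[X_{N-1},X_N]$. Let $S:I\to\mathbb{R}$ be bounded and piecewise continuous, where the only possible discontinuities are finite jumps occurring at the points $X_1,\dots,X_{N-1}$. Let $s=\sup\{|S(x)|:x\in I\}$. Let $C=C(I)$ be the set of continuous functions $f:I\to\mathbb{R}$, with the metric $d_\infty(f,g)=\max\{|f(x)-g(x)|:x\in I\}$. Let $C^{\ast}=\{f\in C: f(X_0)=Y_0,\ f(X_N)=Y_N\}$ and $C^{\ast\ast}=\{f\in C: f(X_j)=Y_j \text{ for } j=0,1,\dots,N\}$. Let $b\in C^{\ast}$ and $h\in C^{\ast\ast}$. The operator $T$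 is defined for $g\in C^{\ast}$ by $$Tg = h+S\cdot(g\circ L-b\circ L).$$ *)

theory Defs
  imports "HOL-Analysis.Analysis"
begin

text \<open>
  A function on the interval \<open>I = {X 0..X N}\<close> is represented by an extensional function
  (constantly \<open>undefined\<close> outside \<open>I\<close>), so that equality of functions is equality on \<open>I\<close>.
\<close>

definition C_metric :: "nat \<Rightarrow> (nat \<Rightarrow> real) \<Rightarrow> (real \<Rightarrow> real) metric" where
  "C_metric N X = cfunspace (top_of_set {X 0..X N}) euclidean_metric"

definition C_space :: "nat \<Rightarrow> (nat \<Rightarrow> real) \<Rightarrow> (real \<Rightarrow> real) set" where
  "C_space N X = mspace (C_metric N X)"

definition d_inf :: "nat \<Rightarrow> (nat \<Rightarrow> real) \<Rightarrow> (real \<Rightarrow> real) \<Rightarrow> (real \<Rightarrow> real) \<Rightarrow> real" where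
  "d_inf N X = mdist (C_metric N X)"

definition C_star :: "nat \<Rightarrow> (nat \<Rightarrow> real) \<Rightarrow> (nat \<Rightarrow> real) \<Rightarrow> (real \<Rightarrow> real) set" where
  "C_star N X Y = {f \<in> C_space N X. f (X 0) = Y 0 \<and> f (X N) = Y N}"

definition C_star_star :: "nat \<Rightarrow> (nat \<Rightarrow> real) \<Rightarrow> (nat \<Rightarrow> real) \<Rightarrow> (real \<Rightarrow> real) set" where
  "C_star_star N X Y = {f \<in> C_space N X. \<forall>j\<le>N. f (X j) = Y j}"

definition cell :: "nat \<Rightarrow> (nat \<Rightarrow> real) \<Rightarrow> nat \<Rightarrow> real set" where
  "cell N X n = (if n = N then {X (n - 1)..X n} else {X (n - 1)..<X n})"

text \<open>
  For strictly increasing \<open>X\<close>, every point of \<open>I\<close> lies in exactly one cell (see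
  \<open>L_map_cell\<close> below); outside \<open>I\<close> the value is irrelevant.
\<close>

definition L_map :: "nat \<Rightarrow> (nat \<Rightarrow> real) \<Rightarrow> (nat \<Rightarrow> real \<Rightarrow> real) \<Rightarrow> real \<Rightarrow> real" where
  "L_map N X l x =
     inv_into {X 0..X N} (l (THE n. n \<in> {1..N} \<and> x \<in> cell N X n)) x"

text \<open>
  The value at a jump point \<open>X j\<close> is arbitrary; it need not be one of the one-sided limits.
\<close>

definition piecewise_cont :: "nat \<Rightarrow> (nat \<Rightarrow> real) \<Rightarrow> (real \<Rightarrow> real) \<Rightarrow> bool" where
  "piecewise_cont N X S \<longleftrightarrow>
     (\<forall>x \<in> {X 0..X N} - X ` {1..N-1}. continuous (at x within {X 0..X N}) S) \<and>
     (\<forall>j \<in> {1..N-1}. (\<exists>a. (S \<longlongrightarrow> a) (at_left (X j))) \<and> (\<exists>c. (S \<longlongrightarrow> c) (at_right (X j))))"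

definition T_op ::
  "nat \<Rightarrow> (nat \<Rightarrow> real) \<Rightarrow> (nat \<Rightarrow> real \<Rightarrow> real) \<Rightarrow> (real \<Rightarrow> real) \<Rightarrow> (real \<Rightarrow> real) \<Rightarrow>
   (real \<Rightarrow> real) \<Rightarrow> (real \<Rightarrow> real) \<Rightarrow> real \<Rightarrow> real" where
  "T_op N X l S b h g =
     (\<lambda>x\<in>{X 0..X N}. h x + S x * (g (L_map N X l x) - b (L_map N X l x)))"

definition contraction_on :: "('a \<Rightarrow> 'a \<Rightarrow> real) \<Rightarrow> 'a set \<Rightarrow> ('a \<Rightarrow> 'a) \<Rightarrow> bool" where
  "contraction_on d A F \<longleftrightarrow>
     F \<in> A \<rightarrow> A \<and> (\<exists>k. 0 \<le> k \<and> k < 1 \<and> (\<forall>x\<in>A. \<forall>y\<in>A. d (F x) (F y) \<le> k * d x y))"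

lemma C_space_iff:
  "f \<in> C_space N X \<longleftrightarrow> f \<in> extensional {X 0..X N} \<and> continuous_on {X 0..X N} f"
proof -
  have "compactin (top_of_set {X 0..X N}) (topspace (top_of_set {X 0..X N}))"
    by (simp add: compactin_subtopology)
  from compactin_mspace_cfunspace[OF this, of "euclidean_metric :: real metric"]
  show ?thesis
    by (simp add: C_space_def C_metric_def del: mspace_cfunspace)
qed

lemma d_inf_is_max:
  assumes f: "f \<in> C_space N X" and g: "g \<in> C_space N X" and "X 0 \<le> X N"
  shows "\<exists>x\<in>{X 0..X N}. d_inf N X f g = \<bar>f x - g x\<bar> \<and>
           (\<forall>y\<in>{X 0..X N}. \<bar>f y - g y\<bar> \<le> \<bar>f x - g x\<bar>)"
proof -
  have le: "d_inf N X f g \<le> a \<longleftrightarrow> (\<forall>x\<in>{X 0..X N}. \<bar>f x - g x\<bar> \<le> a)" for a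
    using cfunspace_mdist_le[of f "top_of_set {X 0..X N}" euclidean_metric g a] assms
    unfolding C_space_def C_metric_def d_inf_def
    by (simp add: dist_real_def del: mspace_cfunspace)
  have "continuous_on {X 0..X N} (\<lambda>x. \<bar>f x - g x\<bar>)"
    using f g by (auto simp: C_space_iff intro!: continuous_intros)
  then obtain x where x: "x \<in> {X 0..X N}"
      and max: "\<forall>y\<in>{X 0..X N}. \<bar>f y - g y\<bar> \<le> \<bar>f x - g x\<bar>"
    using continuous_attains_sup[of "{X 0..X N}" "\<lambda>x. \<bar>f x - g x\<bar>"] \<open>X 0 \<le> X N\<close> by auto
  have "d_inf N X f g = \<bar>f x - g x\<bar>"
    using le[of "\<bar>f x - g x\<bar>"] le[of "d_inf N X f g"] x max by (meson order.antisym order.refl)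
  with x max show ?thesis by blast
qed

lemma ex1_cell:
  assumes "\<And>j. j < N \<Longrightarrow> X j < X (Suc j)" and "x \<in> {X 0..X N}" and "1 \<le> N"
  shows "\<exists>!n. n \<in> {1..N} \<and> x \<in> cell N X n"
proof -
  have mono: "X i \<le> X j" if "i \<le> j" "j \<le> N" for i j
    using that
  proof (induction j rule: dec_induct)
    case (step k)
    then show ?case using assms(1)[of k] by simp
  qed simp
  have uniq: "m = n" if m: "m \<in> {1..N}" "x \<in> cell N X m" and n: "n \<in> {1..N}" "x \<in> cell N X n" for m n
  proof (rule ccontr)
    have *: False if "p < q" "p \<in> {1..N}" "q \<in> {1..N}" "x \<in> cell N X p" "x \<in> cell N X q" for p q
    proof -
      have "X p \<le> X (q - 1)" using that by (intro mono) auto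
      moreover have "x < X p" using that by (auto simp: cell_def)
      moreover have "X (q - 1) \<le> x" using that by (auto simp: cell_def split: if_splits)
      ultimately show False by linarith
    qed
    assume "m \<noteq> n"
    then show False using *[of m n] *[of n m] m n by (metis nat_neq_iff)
  qed
  have "\<exists>n. n \<in> {1..N} \<and> x \<in> cell N X n"
  proof (cases "x = X N")
    case True
    then show ?thesis using mono[of "N - 1" N] \<open>1 \<le> N\<close> by (intro exI[of _ N]) (auto simp: cell_def)
  next
    case False
    then have "x < X N" using assms(2) by simp
    define n where "n = (LEAST n. x < X n)"
    have n: "x < X n" unfolding n_def using \<open>x < X N\<close> by (rule LeastI)
    have "n \<le> N" unfolding n_def using \<open>x < X N\<close> by (rule Least_le)
    have "n \<noteq> 0" using n assms(2) by (metis atLeastAtMost_iff not_le)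
    then have "\<not> x < X (n - 1)" using not_less_Least[of "n - 1" "\<lambda>n. x < X n"] n_def by simp
    then show ?thesis using n \<open>n \<le> N\<close> \<open>n \<noteq> 0\<close> by (intro exI[of _ n]) (auto simp: cell_def)
  qed
  then show ?thesis using uniq by blast
qed

lemma cell_subset:
  assumes "\<And>j. j < N \<Longrightarrow> X j < X (Suc j)" and "n \<in> {1..N}"
  shows "cell N X n \<subseteq> {X 0..X N}"
proof -
  have mono: "X i \<le> X j" if "i \<le> j" "j \<le> N" for i j
    using that
  proof (induction j rule: dec_induct)
    case (step k)
    then show ?case using assms(1)[of k] by simp
  qed simp
  have "X 0 \<le> X (n - 1)" "X n \<le> X N" using assms(2) by (auto intro!: mono)
  then show ?thesis by (auto simp: cell_def)
qed

lemma L_map_cell: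
  assumes "\<And>j. j < N \<Longrightarrow> X j < X (Suc j)" and "n \<in> {1..N}" and "x \<in> cell N X n"
  shows "L_map N X l x = inv_into {X 0..X N} (l n) x"
proof -
  have "x \<in> {X 0..X N}" using cell_subset[of N X n] assms by blast
  moreover have "1 \<le> N" using assms(2) by auto
  ultimately have "\<exists>!n. n \<in> {1..N} \<and> x \<in> cell N X n" using ex1_cell[of N X x] assms(1) by blast
  then have "(THE n. n \<in> {1..N} \<and> x \<in> cell N X n) = n"
    by (rule the1_equality) (use assms in blast)
  then show ?thesis by (simp add: L_map_def)
qed

end

theory Submission
  imports Defs
begin

text \<open>
  The map \<open>L\<close> may jump at the inner nodes and \<open>S\<close> may jump there as well, yet \<open>T g\<close> is continuous.
  The reason is that \<open>u = g - b\<close> vanishes at both ends of \<open>I\<close>. A continuous bijection \<open>l n\<close> is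
  monotone, so its inverse sends the two nodes that bound its cell to end points of \<open>I\<close>. Hence at
  every node \<open>u \<circ> L\<close> takes the value \<open>0\<close> and tends to \<open>0\<close> from each side within \<open>I\<close>: the
  jumps of \<open>L\<close> disappear from \<open>u \<circ> L\<close> (\<open>continuous_on_comp_L_map\<close>). Where \<open>S\<close> jumps, the bounded
  function \<open>S\<close> is multiplied by a function tending to \<open>0\<close>, so its jumps disappear too
  (\<open>continuous_on_bounded_mult_zero\<close>). As \<open>u \<circ> L\<close> is \<open>0\<close> at the nodes, \<open>T g\<close> interpolates there
  as \<open>h\<close> does. Together this gives \<open>T_op_in_C_star_star\<close>.

  In \<open>T g\<^sub>1 - T g\<^sub>2\<close> the functions \<open>h\<close> and \<open>b\<close> cancel and leave \<open>S \<cdot> (g\<^sub>1 \<circ> L - g\<^sub>2 \<circ> L)\<close>, which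
  is the Lipschitz estimate. Prescribing values at points is a closed condition, so \<open>C\<^sup>*\<close> is a
  complete metric space (\<open>mcomplete_C_star\<close>) and Banach's theorem applies to it. The fixed point
  lies in the image of \<open>T\<close>, hence in \<open>C\<^sup>*\<^sup>*\<close>.
\<close>

section \<open>The uniform metric\<close>

lemma C_star_star_subset: "C_star_star N X Y \<subseteq> C_star N X Y"
  by (auto simp: C_star_star_def C_star_def)

lemma d_inf_le_iff:
  assumes "f \<in> C_space N X" "g \<in> C_space N X" "X 0 \<le> X N"
  shows "d_inf N X f g \<le> a \<longleftrightarrow> (\<forall>x\<in>{X 0..X N}. \<bar>f x - g x\<bar> \<le> a)"
  using d_inf_is_max[OF assms] by (metis order_trans)

lemma abs_diff_le_d_inf:
  assumes "f \<in> C_space N X" "g \<in> C_space N X" "x \<in> {X 0..X N}"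
  shows "\<bar>f x - g x\<bar> \<le> d_inf N X f g"
  using d_inf_le_iff[OF assms(1,2)] assms(3) by fastforce

lemma bdd_above_abs_image:
  fixes S :: "'a \<Rightarrow> real"
  shows "bounded (S ` A) \<Longrightarrow> bdd_above ((\<lambda>x. \<bar>S x\<bar>) ` A)"
  by (auto simp: bounded_iff bdd_above_def)

lemma SUP_abs_nonneg:
  fixes S :: "'a \<Rightarrow> real"
  assumes "bounded (S ` A)" and x: "x \<in> A"
  shows "0 \<le> (SUP x\<in>A. \<bar>S x\<bar>)"
  using cSUP_upper[OF x bdd_above_abs_image[OF assms(1)]] by linarith

lemma mcomplete_C_space: "Metric_space.mcomplete (C_space N X) (d_inf N X)"
proof -
  have "mcomplete_of (cfunspace (top_of_set {X 0..X N}) (euclidean_metric :: real metric))"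
    using Met_TC.mcomplete_cfunspace[of "top_of_set {X 0..X N}"] complete_UNIV
    by (simp add: mcomplete_iff_complete euclidean_metric_def Met_TC.Self_def)
  then show ?thesis
    by (simp add: mcomplete_of_def C_space_def d_inf_def C_metric_def)
qed

text \<open>
  Convergence in \<open>d_inf\<close> implies convergence at each single point, so the two end point
  conditions survive limits and \<open>C_star\<close> inherits completeness.
\<close>

lemma mcomplete_C_star:
  assumes "X 0 \<le> X N"
  shows "Metric_space.mcomplete (C_star N X Y) (d_inf N X)"
proof -
  interpret Metric_space "C_space N X" "d_inf N X"
    unfolding C_space_def d_inf_def by (rule Metric_space_mspace_mdist)
  interpret Submetric "C_space N X" "d_inf N X" "C_star N X Y"
    by unfold_locales (auto simp: C_star_def)
  have lim_pt: "f x = c"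
    if lim: "limitin mtopology \<sigma> f sequentially" and x: "x \<in> {X 0..X N}"
      and c: "\<And>n. \<sigma> n x = c" for \<sigma> f x c
  proof (rule ccontr)
    assume "f x \<noteq> c"
    then obtain n where n: "\<sigma> n \<in> C_space N X" "d_inf N X (\<sigma> n) f < \<bar>c - f x\<bar>"
      using lim unfolding limit_metric_sequentially
      by (metis order_refl zero_less_abs_iff right_minus_eq)
    moreover have "f \<in> C_space N X"
      using lim by (simp add: limit_metric_sequentially)
    ultimately show False
      using abs_diff_le_d_inf[of "\<sigma> n" N X f x] x c[of n] by auto
  qed
  have "f \<in> C_star N X Y"
    if "range \<sigma> \<subseteq> C_star N X Y" and lim: "limitin mtopology \<sigma> f sequentially" for \<sigma> f
  proof -
    have "\<sigma> n (X 0) = Y 0" "\<sigma> n (X N) = Y N" for n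
      using that(1) by (auto simp: C_star_def)
    then have "f (X 0) = Y 0" "f (X N) = Y N"
      using lim_pt[OF lim] assms by auto
    then show ?thesis
      using lim by (simp add: C_star_def limit_metric_sequentially)
  qed
  then show ?thesis
    using sequentially_closedin_mcomplete_imp_mcomplete[OF mcomplete_C_space] by blast
qed

section \<open>Continuity across the nodes\<close>

lemma inv_into_bij_betw_end_point:
  fixes f :: "real \<Rightarrow> real"
  assumes cont: "continuous_on {a..b} f" and bij: "bij_betw f {a..b} {c..d}"
    and "c \<le> d" and y: "y = c \<or> y = d"
  shows "inv_into {a..b} f y = a \<or> inv_into {a..b} f y = b"
proof (rule ccontr)
  assume neq: "\<not> ?thesis"
  define x where "x = inv_into {a..b} f y"
  have img: "f ` {a..b} = {c..d}"
    using bij by (simp add: bij_betw_def)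
  have "y \<in> f ` {a..b}"
    using y \<open>c \<le> d\<close> img by auto
  then have x: "x \<in> {a..b}" "f x = y"
    unfolding x_def by (rule inv_into_into, rule f_inv_into_f)
  then have "a < x" "x < b"
    using neq x_def by auto
  \<comment> \<open>An inner point would be mapped strictly between two points of \<open>{c..d}\<close>.\<close>
  then have "(f a < y \<and> y < f b) \<or> (f b < y \<and> y < f a)"
    using continuous_inj_imp_mono[OF _ _ cont bij_betw_imp_inj_on[OF bij], of x] x by auto
  moreover have "f a \<in> {c..d}" "f b \<in> {c..d}"
    using x(1) img by auto
  ultimately show False
    using y by auto
qed

text \<open>
  At a zero of \<open>v\<close> the bounded factor \<open>S\<close> cannot keep the product away from \<open>0\<close>, so a
  discontinuity of \<open>S\<close> there leaves no trace in \<open>S * v\<close>.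
\<close>

lemma continuous_on_bounded_mult_zero:
  fixes S v :: "'a::t2_space \<Rightarrow> real"
  assumes v: "continuous_on A v" and S: "bounded (S ` A)"
    and *: "\<And>x. x \<in> A \<Longrightarrow> v x = 0 \<or> continuous (at x within A) S"
  shows "continuous_on A (\<lambda>x. S x * v x)"
  unfolding continuous_on_eq_continuous_within
proof
  fix x assume x: "x \<in> A"
  have cv: "continuous (at x within A) v"
    using v x by (simp add: continuous_on_eq_continuous_within)
  obtain B where B: "norm (S y) \<le> B" if "y \<in> A" for y
    using S by (auto simp: bounded_iff)
  show "continuous (at x within A) (\<lambda>x. S x * v x)"
  proof (cases "v x = 0")
    case True
    have "((\<lambda>x. v x * S x) \<longlongrightarrow> 0) (at x within A)"
    proof (rule lim_null_mult_right_bounded)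
      show "\<forall>\<^sub>F y in at x within A. norm (S y) \<le> B"
        using B by (auto simp: eventually_at_filter)
      show "(v \<longlongrightarrow> 0) (at x within A)"
        using cv True by (simp add: continuous_within)
    qed
    then show ?thesis
      using True by (simp add: continuous_within mult.commute)
  next
    case False
    then show ?thesis
      using *[OF x] cv by (intro continuous_mult) auto
  qed
qed

locale interpolation_grid =
  fixes N :: nat and X :: "nat \<Rightarrow> real" and l :: "nat \<Rightarrow> real \<Rightarrow> real"
  assumes N_ge_1: "1 \<le> N"
    and X_less: "\<And>j. j < N \<Longrightarrow> X j < X (Suc j)"
    and cont_l: "\<And>n. n \<in> {1..N} \<Longrightarrow> continuous_on {X 0..X N} (l n)"
    and bij_l: "\<And>n. n \<in> {1..N} \<Longrightarrow> bij_betw (l n) {X 0..X N} {X (n - 1)..X n}"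
begin

lemma X_mono: "i \<le> j \<Longrightarrow> j \<le> N \<Longrightarrow> X i \<le> X j"
proof (induction j rule: dec_induct)
  case (step k)
  then show ?case using X_less[of k] by simp
qed simp

lemma node_in_interval: "j \<le> N \<Longrightarrow> X j \<in> {X 0..X N}"
  by (simp add: X_mono)

lemma X_pred_less: "n \<in> {1..N} \<Longrightarrow> X (n - 1) < X n"
  using X_less[of "n - 1"] by fastforce

lemma exists_cell:
  assumes "x \<in> {X 0..X N}"
  obtains n where "n \<in> {1..N}" "x \<in> cell N X n"
  using ex1_cell[of N X x] X_less N_ge_1 assms by blast

lemma L_map_in_interval:
  assumes x: "x \<in> {X 0..X N}"
  shows "L_map N X l x \<in> {X 0..X N}"
proof -
  obtain n where n: "n \<in> {1..N}" "x \<in> cell N X n"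
    using exists_cell[OF x] .
  then have "x \<in> l n ` {X 0..X N}"
    using bij_betw_imp_surj_on[OF bij_l[OF n(1)]] by (auto simp: cell_def split: if_splits)
  then show ?thesis
    using inv_into_into L_map_cell[of N X n x l] n X_less by metis
qed

lemma inv_l_node:
  assumes "n \<in> {1..N}" and "x = X (n - 1) \<or> x = X n"
  shows "inv_into {X 0..X N} (l n) x = X 0 \<or> inv_into {X 0..X N} (l n) x = X N"
  using inv_into_bij_betw_end_point[OF cont_l bij_l] assms X_pred_less[OF assms(1)] by simp

lemma L_map_node:
  assumes "j \<le> N"
  shows "L_map N X l (X j) = X 0 \<or> L_map N X l (X j) = X N"
proof -
  \<comment> \<open>The cells are half-open, so every node but the last is the left end of the cell containing it.\<close>
  define n where "n = (if j = N then N else Suc j)"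
  have n: "n \<in> {1..N}" "X j = X (n - 1) \<or> X j = X n"
    using assms N_ge_1 by (auto simp: n_def)
  moreover have "X j \<in> cell N X n"
    using X_pred_less[OF n(1)] assms by (auto simp: n_def cell_def)
  ultimately show ?thesis
    using inv_l_node[of n "X j"] L_map_cell[of N X n "X j" l] X_less by simp
qed

lemma interval_eq_Union_cells: "{X 0..X N} = (\<Union>n\<in>{1..N}. {X (n - 1)..X n})"
proof
  show "{X 0..X N} \<subseteq> (\<Union>n\<in>{1..N}. {X (n - 1)..X n})"
  proof
    fix x assume "x \<in> {X 0..X N}"
    then obtain n where "n \<in> {1..N}" "x \<in> cell N X n"
      by (rule exists_cell)
    then show "x \<in> (\<Union>n\<in>{1..N}. {X (n - 1)..X n})"
      by (intro UN_I[of n]) (auto simp: cell_def split: if_splits)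
  qed
  show "(\<Union>n\<in>{1..N}. {X (n - 1)..X n}) \<subseteq> {X 0..X N}"
  proof
    fix x assume "x \<in> (\<Union>n\<in>{1..N}. {X (n - 1)..X n})"
    then obtain n where n: "n \<in> {1..N}" "X (n - 1) \<le> x" "x \<le> X n"
      by auto
    have "X 0 \<le> X (n - 1)" "X n \<le> X N"
      using n(1) by (auto intro!: X_mono)
    then show "x \<in> {X 0..X N}"
      using n by auto
  qed
qed

text \<open>
  On a closed cell \<open>u \<circ> L\<close> agrees with the continuous function \<open>u \<circ> (l n)\<^sup>-\<^sup>1\<close>, even at a right
  end below \<open>X N\<close>, where \<open>L\<close> itself already follows the next branch: both values are \<open>u\<close> at an
  end point of \<open>I\<close>, that is \<open>0\<close>. Finitely many closed cells cover \<open>I\<close>, so these pieces glue.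
\<close>

lemma continuous_on_comp_L_map:
  fixes u :: "real \<Rightarrow> real"
  assumes u: "continuous_on {X 0..X N} u" and u0: "u (X 0) = 0" "u (X N) = 0"
  shows "continuous_on {X 0..X N} (\<lambda>x. u (L_map N X l x))"
proof -
  have piece: "continuous_on {X (n - 1)..X n} (\<lambda>x. u (L_map N X l x))" if n: "n \<in> {1..N}" for n
  proof -
    have img: "l n ` {X 0..X N} = {X (n - 1)..X n}"
      using bij_l[OF n] by (simp add: bij_betw_def)
    have inj: "inj_on (l n) {X 0..X N}"
      using bij_l[OF n] by (simp add: bij_betw_def)
    have "continuous_on (l n ` {X 0..X N}) (inv_into {X 0..X N} (l n))"
      using cont_l[OF n] inj by (intro continuous_on_inv) auto
    moreover have "inv_into {X 0..X N} (l n) ` {X (n - 1)..X n} \<subseteq> {X 0..X N}"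
      unfolding img[symmetric] by (blast intro: inv_into_into)
    ultimately have "continuous_on {X (n - 1)..X n} (\<lambda>x. u (inv_into {X 0..X N} (l n) x))"
      using continuous_on_compose2[OF u] img by metis
    moreover have "u (L_map N X l x) = u (inv_into {X 0..X N} (l n) x)"
      if x: "x \<in> {X (n - 1)..X n}" for x
    proof (cases "x \<in> cell N X n")
      case True
      then show ?thesis
        using L_map_cell[of N X n x l] n X_less by simp
    next
      case False
      then have "x = X n"
        using x by (auto simp: cell_def split: if_splits)
      then show ?thesis
        using L_map_node[of n] inv_l_node[OF n, of x] n u0 by auto
    qed
    ultimately show ?thesis
      using continuous_on_cong[OF refl] by metis
  qed
  show ?thesis
    unfolding interval_eq_Union_cells
    by (rule continuous_on_closed_Union) (use piece in auto)
qed

section \<open>The operator\<close>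

lemma T_op_in_C_star_star:
  assumes S: "bounded (S ` {X 0..X N})" "piecewise_cont N X S"
    and b: "b \<in> C_star N X Y" and h: "h \<in> C_star_star N X Y" and g: "g \<in> C_star N X Y"
  shows "T_op N X l S b h g \<in> C_star_star N X Y"
proof -
  define v where "v x = g (L_map N X l x) - b (L_map N X l x)" for x
  have v_node: "v (X j) = 0" if "j \<le> N" for j
    using L_map_node[OF that] b g by (auto simp: v_def C_star_def)
  have "continuous_on {X 0..X N} (\<lambda>x. g x - b x)"
    using b g by (auto simp: C_star_def C_space_iff intro: continuous_on_diff)
  then have "continuous_on {X 0..X N} v"
    unfolding v_def
    by (rule continuous_on_comp_L_map) (use b g in \<open>auto simp: C_star_def\<close>)
  then have "continuous_on {X 0..X N} (\<lambda>x. S x * v x)"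
  proof (rule continuous_on_bounded_mult_zero[OF _ S(1)])
    fix x assume "x \<in> {X 0..X N}"
    then show "v x = 0 \<or> continuous (at x within {X 0..X N}) S"
      using S(2) v_node by (cases "x \<in> X ` {1..N-1}") (auto simp: piecewise_cont_def)
  qed
  then have cont: "continuous_on {X 0..X N} (\<lambda>x. h x + S x * v x)"
    using h by (intro continuous_on_add) (auto simp: C_star_star_def C_space_iff)
  have T_eq: "T_op N X l S b h g = (\<lambda>x\<in>{X 0..X N}. h x + S x * v x)"
    by (simp add: T_op_def v_def)
  have "continuous_on {X 0..X N} (T_op N X l S b h g)"
    using cont by (rule continuous_on_eq) (simp add: T_eq)
  then show ?thesis
    using h v_node node_in_interval
    by (simp add: C_star_star_def C_space_iff T_eq)
qed

lemma d_inf_T_op_le: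
  assumes S: "bounded (S ` {X 0..X N})" "piecewise_cont N X S"
    and b: "b \<in> C_star N X Y" and h: "h \<in> C_star_star N X Y"
    and g: "g1 \<in> C_star N X Y" "g2 \<in> C_star N X Y"
  shows "d_inf N X (T_op N X l S b h g1) (T_op N X l S b h g2)
    \<le> (SUP x\<in>{X 0..X N}. \<bar>S x\<bar>) * d_inf N X g1 g2"
proof -
  let ?s = "SUP x\<in>{X 0..X N}. \<bar>S x\<bar>"
  have T: "T_op N X l S b h g1 \<in> C_space N X" "T_op N X l S b h g2 \<in> C_space N X"
    using T_op_in_C_star_star[OF S b h] g by (auto simp: C_star_star_def)
  have g': "g1 \<in> C_space N X" "g2 \<in> C_space N X"
    using g by (auto simp: C_star_def)
  have "\<bar>T_op N X l S b h g1 x - T_op N X l S b h g2 x\<bar> \<le> ?s * d_inf N X g1 g2"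
    if x: "x \<in> {X 0..X N}" for x
  proof -
    let ?y = "L_map N X l x"
    have "T_op N X l S b h g1 x - T_op N X l S b h g2 x = S x * (g1 ?y - g2 ?y)"
      using x by (simp add: T_op_def algebra_simps)
    then have "\<bar>T_op N X l S b h g1 x - T_op N X l S b h g2 x\<bar> = \<bar>S x\<bar> * \<bar>g1 ?y - g2 ?y\<bar>"
      by (simp add: abs_mult)
    also have "\<dots> \<le> ?s * d_inf N X g1 g2"
    proof (rule mult_mono)
      show le: "\<bar>S x\<bar> \<le> ?s"
        using cSUP_upper[OF x bdd_above_abs_image[OF S(1)]] .
      then show "0 \<le> ?s"
        by linarith
    qed (use abs_diff_le_d_inf[OF g' L_map_in_interval[OF x]] in auto)
    finally show ?thesis .
  qed
  then show ?thesis
    using d_inf_le_iff[OF T X_mono[OF le0 order_refl]] by blast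
qed

end

theorem theorem3:
  fixes N :: nat
    and X Y :: "nat \<Rightarrow> real"
    and l :: "nat \<Rightarrow> real \<Rightarrow> real"
    and S b h :: "real \<Rightarrow> real"
  assumes "1 \<le> N"
    and "\<And>j. j < N \<Longrightarrow> X j < X (Suc j)"
    and "\<And>n. n \<in> {1..N} \<Longrightarrow> continuous_on {X 0..X N} (l n)"
    and "\<And>n. n \<in> {1..N} \<Longrightarrow> bij_betw (l n) {X 0..X N} {X (n - 1)..X n}"
    and "bounded (S ` {X 0..X N})"
    and "piecewise_cont N X S"
    and "b \<in> C_star N X Y"
    and "h \<in> C_star_star N X Y"
  shows "T_op N X l S b h \<in> C_star N X Y \<rightarrow> C_star_star N X Y \<and>
    (\<forall>g1 \<in> C_star N X Y. \<forall>g2 \<in> C_star N X Y.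
       d_inf N X (T_op N X l S b h g1) (T_op N X l S b h g2)
         \<le> (SUP x\<in>{X 0..X N}. \<bar>S x\<bar>) * d_inf N X g1 g2) \<and>
    ((SUP x\<in>{X 0..X N}. \<bar>S x\<bar>) < 1 \<longrightarrow>
       contraction_on (d_inf N X) (C_star N X Y) (T_op N X l S b h) \<and>
       (\<exists>f \<in> C_star_star N X Y. T_op N X l S b h f = f \<and>
          (\<forall>g \<in> C_star N X Y. T_op N X l S b h g = g \<longrightarrow> g = f)))"
proof -
  interpret interpolation_grid N X l
    using assms(1-4) by unfold_locales
  let ?T = "T_op N X l S b h" and ?s = "SUP x\<in>{X 0..X N}. \<bar>S x\<bar>"
  have T: "?T \<in> C_star N X Y \<rightarrow> C_star_star N X Y"
    using T_op_in_C_star_star[OF assms(5-8)] by blast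
  then have T': "?T \<in> C_star N X Y \<rightarrow> C_star N X Y"
    using C_star_star_subset by blast
  have lip: "d_inf N X (?T g1) (?T g2) \<le> ?s * d_inf N X g1 g2"
    if "g1 \<in> C_star N X Y" "g2 \<in> C_star N X Y" for g1 g2
    using d_inf_T_op_le[OF assms(5-8) that] .
  have "contraction_on (d_inf N X) (C_star N X Y) ?T \<and>
      (\<exists>f \<in> C_star_star N X Y. ?T f = f \<and> (\<forall>g \<in> C_star N X Y. ?T g = g \<longrightarrow> g = f))"
    if s: "?s < 1"
  proof -
    interpret M: Metric_space "C_star N X Y" "d_inf N X"
      unfolding d_inf_def
      by (rule Metric_space.subspace[OF Metric_space_mspace_mdist])
        (auto simp: C_star_def C_space_def)
    obtain f where f: "f \<in> C_star N X Y" "?T f = f"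
      using M.Banach_fixedpoint_thm[OF mcomplete_C_star[OF X_mono[OF le0 order_refl]] _ T' s lip]
        assms(7) by blast
    then have "f \<in> C_star_star N X Y"
      using T by (metis funcset_mem)
    moreover have "g = f" if "g \<in> C_star N X Y" "?T g = g" for g
      using M.contraction_imp_unique_fixpoint[OF that(2) f(2) T' s lip that(1) f(1)] .
    moreover have "contraction_on (d_inf N X) (C_star N X Y) ?T"
      unfolding contraction_on_def using T' lip s SUP_abs_nonneg[OF assms(5) node_in_interval[OF le0]] by blast
    ultimately show ?thesis
      using f(2) by blast
  qed
  then show ?thesis
    using T lip by blast
qed

end
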